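(* Let $G$ be a connected finite loopless multigraph of genus $g$ with canonical divisor $K$. For any divisor $D$ on $G$, \[ r(D) - r(K-D) = \deg(D) + 1 - g, \] where $r(\cdot)$ denotes the Baker--Norine rank.
   Context: A finite loopless multigraph $G=(V,E)$ has a finite nonempty vertex set $V=V(G)$ and a finite multiset $E=E(G)$ of unordered pairs $\{v,w\}$ of vertices with $v\neq w$. $G$ is connected if for every nonempty proper subset $S\subsetneq V$ there is at least one edge between $S$ and $V\setminus S$. The genus of $G$ is $g=|E|-|V|+1$ (edges counted with multiplicity). A divisor on $G$ is a function $D:V\to\mathbb{Z}$; divisors form the abelian group $\mathrm{Div}(G)=\mathbb{Z}^V$ under pointwise addition. The degree is $\deg(D)=\sum_{v\in V}D(v)$. Firing a vertex $v$ means sending one chip along each edge incident to $v$: $D(v)$ decreases by $\mathrm{val}(v)$ (the number of edges incident to $v$, with multiplicity) and $D(w)$ increases by the number of edges between $v$ and $w$ for each $w\neq v$. The firing vector of $v$ is the divisor that firing $v$ adds. The principal divisors are the subgroup generated by all firing vectors; $D\sim D'$ (linear equivalence) means $D-D'$ is principal. A divisor is effective if all its values are $\ge 0$, and winnable if it is linearly equivalent to an effective divisor; otherwise it is unwinnable. The canonical divisor $K$ is $K(v)=\mathrm{val}(v)-2$. The Baker--Norine rank $r(D)\in\mathbb{Z}$ is $r(D)=\deg(E)-1$, where $E$ is an effective divisor of minimum degree such that $D-E$ is unwinnable; in particular $r(D)=-1$ if $D$ is unwinnable. *)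

theory Defs
  imports
    "HOL-Library.Multiset"
    "HOL-Library.Function_Algebras"
    "HOL-Computational_Algebra.Group_Closure"
begin

text \<open>
  An edge joining distinct vertices v and w is the set {v, w}; parallel edges are
  recorded by multiplicity in the multiset of edges.
\<close>

locale multigraph =
  fixes V :: "'v set" and E :: "'v set multiset"
  assumes finite_vertices: "finite V"
    and vertices_nonempty: "V \<noteq> {}"
    and edges: "\<And>e. e \<in># E \<Longrightarrow> \<exists>v\<in>V. \<exists>w\<in>V. v \<noteq> w \<and> e = {v, w}"

locale connected_multigraph = multigraph +
  assumes connected:
    "\<And>S. S \<noteq> {} \<Longrightarrow> S \<subset> V \<Longrightarrow> \<exists>v\<in>S. \<exists>w\<in>V - S. {v, w} \<in># E"

definition genus :: "'v set \<Rightarrow> 'v set multiset \<Rightarrow> int" where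
  "genus V E = int (size E) - int (card V) + 1"

definition val :: "'v set multiset \<Rightarrow> 'v \<Rightarrow> nat" where
  "val E v = size {#e \<in># E. v \<in> e#}"

text \<open>
  A divisor, an integer-valued function on V, is represented by its extension by zero
  to the whole type. Divisors thus form a subgroup of the group of all integer-valued
  functions under pointwise addition.
\<close>

definition divisors :: "'v set \<Rightarrow> ('v \<Rightarrow> int) set" where
  "divisors V = {D. \<forall>v. v \<notin> V \<longrightarrow> D v = 0}"

definition deg :: "'v set \<Rightarrow> ('v \<Rightarrow> int) \<Rightarrow> int" where
  "deg V D = (\<Sum>v\<in>V. D v)"

definition firing_vector :: "'v set multiset \<Rightarrow> 'v \<Rightarrow> 'v \<Rightarrow> int" where
  "firing_vector E v = (\<lambda>w. if w = v then - int (val E v) else int (count E {v, w}))"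

definition principal_divisors :: "'v set \<Rightarrow> 'v set multiset \<Rightarrow> ('v \<Rightarrow> int) set" where
  "principal_divisors V E = group_closure (firing_vector E ` V)"

definition linearly_equivalent ::
    "'v set \<Rightarrow> 'v set multiset \<Rightarrow> ('v \<Rightarrow> int) \<Rightarrow> ('v \<Rightarrow> int) \<Rightarrow> bool" where
  "linearly_equivalent V E D D' \<longleftrightarrow> D - D' \<in> principal_divisors V E"

definition effective :: "'v set \<Rightarrow> ('v \<Rightarrow> int) \<Rightarrow> bool" where
  "effective V D \<longleftrightarrow> (\<forall>v\<in>V. 0 \<le> D v)"

definition winnable :: "'v set \<Rightarrow> 'v set multiset \<Rightarrow> ('v \<Rightarrow> int) \<Rightarrow> bool" where
  "winnable V E D \<longleftrightarrow> (\<exists>D'\<in>divisors V. effective V D' \<and> linearly_equivalent V E D D')"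

definition canonical_divisor :: "'v set \<Rightarrow> 'v set multiset \<Rightarrow> 'v \<Rightarrow> int" where
  "canonical_divisor V E = (\<lambda>v. if v \<in> V then int (val E v) - 2 else 0)"

text \<open>
  The minimum below is attained: on a multigraph degree is invariant under linear
  equivalence, so D - F is unwinnable whenever F has degree greater than that of D, and
  the degrees of effective divisors are bounded below by 0.
\<close>

definition rank :: "'v set \<Rightarrow> 'v set multiset \<Rightarrow> ('v \<Rightarrow> int) \<Rightarrow> int" where
  "rank V E D =
     deg V (ARG_MIN (deg V) F. F \<in> divisors V \<and> effective V F \<and> \<not> winnable V E (D - F)) - 1"

end

theory Submission
  imports Defs "HOL-Library.Indicator_Function"
begin

text \<open>
  The proof rests on a family of divisors that measure unwinnability. Number the vertices
  injectively and let N be the divisor whose value at v is one less than the number of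
  edges from v to vertices with a smaller number. Three facts about these order divisors
  give the theorem.

  \<^item> An order divisor N is unwinnable, and so is every divisor below it
    (\<open>not_winnable_below_order_divisor\<close>). Of the vertices fired most often, the one with the
    smallest number gains nothing and loses a chip along every edge to a smaller vertex,
    and so it ends in debt.

  \<^item> Every unwinnable divisor D is linearly equivalent to one below some order divisor
    (\<open>unwinnable_equivalent_below_order_divisor\<close>). Within the class of D, a divisor is
    found for which every nonempty set S of vertices contains a vertex that is in debt
    after S is fired; numbering the vertices by repeatedly applying this to the set of
    unnumbered ones (Dhar's burning algorithm) yields the order.

  \<^item> Reversing the numbering turns N into K - N (\<open>order_divisor_add_reverse\<close>), so that all
    order divisors have degree g - 1.

  Now let F be effective of minimal degree such that D - F is unwinnable, and write
  D - F \<open>\<sim>\<close> N - F' with N an order divisor and F' effective. Then K - D - F' \<open>\<sim>\<close> (K - N) - F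
  is unwinnable too, as it lies below the order divisor K - N. So r(K - D) + 1 is at most
  deg F', which equals g - 1 - deg D + (r(D) + 1). This is one of the two inequalities of the theorem, and
  the other one is the same inequality applied to K - D.
\<close>

section \<open>The Laplacian\<close>

text \<open>
  A function c from vertices to integers serves as a firing script: each vertex v is fired
  c v times. Its Laplacian records how many chips each vertex loses in total.
\<close>

definition laplacian :: "'v set \<Rightarrow> 'v set multiset \<Rightarrow> ('v \<Rightarrow> int) \<Rightarrow> 'v \<Rightarrow> int" where
  "laplacian V E c = (\<lambda>v. \<Sum>w\<in>V. int (count E {v, w}) * (c v - c w))"

lemma laplacian_diff: "laplacian V E (c - d) = laplacian V E c - laplacian V E d"
  by (auto simp: laplacian_def fun_eq_iff algebra_simps simp flip: sum_subtractf)

lemma laplacian_add: "laplacian V E (c + d) = laplacian V E c + laplacian V E d"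
  by (auto simp: laplacian_def fun_eq_iff algebra_simps simp flip: sum.distrib)

lemma laplacian_scale: "laplacian V E (\<lambda>v. k * c v) = (\<lambda>v. k * laplacian V E c v)"
  by (simp add: laplacian_def fun_eq_iff sum_distrib_left algebra_simps)

lemma laplacian_zero: "laplacian V E 0 = 0"
  by (simp add: laplacian_def fun_eq_iff)

text \<open>
  The Laplacian is self-adjoint because edges have no direction. Below, this turns the change
  of a weighted chip count under a firing into a sum over the fired vertices.
\<close>

lemma sum_laplacian_mult:
  "(\<Sum>v\<in>V. laplacian V E c v * b v) = (\<Sum>v\<in>V. c v * laplacian V E b v)"
proof -
  have "(\<Sum>v\<in>V. laplacian V E c v * b v) - (\<Sum>v\<in>V. c v * laplacian V E b v)
      = (\<Sum>v\<in>V. \<Sum>w\<in>V. int (count E {v, w}) * (c v * b w))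
      - (\<Sum>v\<in>V. \<Sum>w\<in>V. int (count E {v, w}) * (c w * b v))"
    by (simp add: laplacian_def sum_distrib_left sum_distrib_right algebra_simps
        flip: sum_subtractf)
  also have "(\<Sum>v\<in>V. \<Sum>w\<in>V. int (count E {v, w}) * (c v * b w))
      = (\<Sum>v\<in>V. \<Sum>w\<in>V. int (count E {v, w}) * (c w * b v))"
    by (subst sum.swap) (simp add: insert_commute)
  finally show ?thesis by simp
qed

corollary deg_laplacian: "deg V (laplacian V E c) = 0"
  using sum_laplacian_mult[of V E c "\<lambda>_. 1"]
  by (simp add: deg_def) (simp add: laplacian_def)

lemma deg_diff: "deg V (D - F) = deg V D - deg V F"
  by (simp add: deg_def sum_subtractf)

lemma diff_in_divisors: "D \<in> divisors V \<Longrightarrow> F \<in> divisors V \<Longrightarrow> D - F \<in> divisors V"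
  by (simp add: divisors_def)

context multigraph
begin

lemma count_loop [simp]: "count E {v} = 0"
proof (rule ccontr)
  assume "count E {v} \<noteq> 0"
  then have "{v} \<in># E" by (simp add: count_eq_zero_iff)
  from edges[OF this] show False by auto
qed

lemma count_outside: "v \<notin> V \<or> w \<notin> V \<Longrightarrow> count E {v, w} = 0"
proof (rule ccontr)
  assume *: "v \<notin> V \<or> w \<notin> V" and "count E {v, w} \<noteq> 0"
  then have "{v, w} \<in># E" by (simp add: count_eq_zero_iff)
  from edges[OF this] * show False by (auto simp: doubleton_eq_iff)
qed

lemma val_eq_sum:
  assumes "v \<in> V"
  shows "val E v = (\<Sum>w\<in>V. count E {v, w})"
proof -
  let ?I = "V - {v}"
  have sub: "set_mset {#e \<in># E. v \<in> e#} \<subseteq> (\<lambda>w. {v, w}) ` ?I"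
  proof
    fix e assume "e \<in># {#e \<in># E. v \<in> e#}"
    then have "e \<in># E" "v \<in> e" by auto
    from edges[OF this(1)] this(2) show "e \<in> (\<lambda>w. {v, w}) ` ?I"
      by (auto simp: insert_commute)
  qed
  have "val E v = (\<Sum>e\<in>(\<lambda>w. {v, w}) ` ?I. count {#e \<in># E. v \<in> e#} e)"
    unfolding val_def size_multiset_overloaded_eq
    by (rule sum.mono_neutral_left)
      (use sub finite_vertices in \<open>auto simp: not_in_iff\<close>)
  also have "\<dots> = (\<Sum>w\<in>?I. count E {v, w})"
    by (subst sum.reindex) (auto simp: inj_on_def doubleton_eq_iff)
  also have "\<dots> = (\<Sum>w\<in>V. count E {v, w})"
    by (rule sum.mono_neutral_left) (use finite_vertices in auto)
  finally show ?thesis .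
qed

lemma sum_val: "(\<Sum>v\<in>V. val E v) = 2 * size E"
proof -
  have card_edge: "card {v \<in> V. v \<in> e} = 2" if e: "e \<in># E" for e
  proof -
    obtain v w where "v \<in> V" "w \<in> V" "v \<noteq> w" "e = {v, w}" using edges[OF e] by blast
    then have "{x \<in> V. x \<in> e} = {v, w}" by auto
    then show ?thesis using \<open>v \<noteq> w\<close> by simp
  qed
  have "(\<Sum>v\<in>V. size {#e \<in># M. v \<in> e#}) = (\<Sum>e\<in>#M. card {v \<in> V. v \<in> e})" for M
  proof (induction M)
    case (add e M)
    have "(\<Sum>v\<in>V. size {#e' \<in># add_mset e M. v \<in> e'#})
        = (\<Sum>v\<in>V. (if v \<in> e then 1 else 0) + size {#e' \<in># M. v \<in> e'#})"
      by (rule sum.cong) auto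
    also have "\<dots> = card {v \<in> V. v \<in> e} + (\<Sum>v\<in>V. size {#e' \<in># M. v \<in> e'#})"
      using finite_vertices by (simp add: sum.distrib Int_def flip: sum.inter_filter)
    finally show ?case using add by simp
  qed simp
  then have "(\<Sum>v\<in>V. val E v) = (\<Sum>e\<in>#E. card {v \<in> V. v \<in> e})"
    by (simp add: val_def)
  also have "\<dots> = (\<Sum>e\<in>#E. 2)"
    by (rule arg_cong[where f = sum_mset], rule image_mset_cong) (simp add: card_edge)
  finally show ?thesis by simp
qed

lemma laplacian_in_divisors: "laplacian V E c \<in> divisors V"
  by (simp add: divisors_def laplacian_def count_outside)

lemma firing_vector_eq_laplacian:
  assumes "v \<in> V"
  shows "firing_vector E v = laplacian V E (\<lambda>u. if u = v then -1 else 0)"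
proof
  fix w
  show "firing_vector E v w = laplacian V E (\<lambda>u. if u = v then -1 else 0) w"
  proof (cases "w = v")
    case True
    have "laplacian V E (\<lambda>u. if u = v then -1 else 0) v
        = (\<Sum>u\<in>V. - int (count E {v, u}))"
      unfolding laplacian_def by (rule sum.cong) auto
    then show ?thesis
      using True val_eq_sum[OF assms] by (simp add: firing_vector_def sum_negf)
  next
    case False
    have "laplacian V E (\<lambda>u. if u = v then -1 else 0) w
        = (\<Sum>u\<in>V. if u = v then int (count E {w, u}) else 0)"
      unfolding laplacian_def using False by (intro sum.cong) auto
    then show ?thesis
      using False assms finite_vertices by (simp add: firing_vector_def insert_commute)
  qed
qed

lemma principal_divisors_eq: "principal_divisors V E = range (laplacian V E)"
proof
  show "principal_divisors V E \<subseteq> range (laplacian V E)"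
  proof
    fix P assume "P \<in> principal_divisors V E"
    then show "P \<in> range (laplacian V E)"
      unfolding principal_divisors_def
    proof (induction rule: group_closure.induct)
      case (base s)
      then consider "s = laplacian V E 0" | v where "v \<in> V" "s = firing_vector E v"
        by (auto simp only: laplacian_zero)
      then show ?case by cases (auto simp only: firing_vector_eq_laplacian)
    next
      case (diff s t)
      then obtain c d where "s = laplacian V E c" "t = laplacian V E d" by blast
      then have "s - t = laplacian V E (c - d)" by (simp only: laplacian_diff)
      then show ?case by blast
    qed
  qed
next
  have scale: "(\<lambda>w. k * P w) \<in> principal_divisors V E"
    if P: "P \<in> principal_divisors V E" for k P
  proof (induction k rule: int_induct[where k = 0])
    case base
    show ?case
      by (simp add: principal_divisors_def flip: zero_fun_def)
  next
    case (step1 i)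
    have "(\<lambda>w. (i + 1) * P w) = (\<lambda>w. i * P w) + P" by (auto simp: algebra_simps)
    with step1 P show ?case by (simp add: principal_divisors_def group_closure_add)
  next
    case (step2 i)
    have "(\<lambda>w. (i - 1) * P w) = (\<lambda>w. i * P w) - P" by (auto simp: algebra_simps)
    with step2 P show ?case by (simp add: principal_divisors_def group_closure.diff)
  qed
  show "range (laplacian V E) \<subseteq> principal_divisors V E"
  proof clarify
    fix c :: "'v \<Rightarrow> int"
    \<comment> \<open>Build the script up by adding multiples of one firing vector at a time.\<close>
    have "laplacian V E (\<lambda>u. if u \<in> S then c u else 0) \<in> principal_divisors V E"
      if "finite S" "S \<subseteq> V" for S
      using that
    proof induction
      case empty
      show ?case
        by (simp add: principal_divisors_def laplacian_zero flip: zero_fun_def)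
    next
      case (insert v S)
      have "(\<lambda>u. if u \<in> insert v S then c u else 0)
          = (\<lambda>u. if u \<in> S then c u else 0) + (\<lambda>u. (- c v) * (if u = v then -1 else 0))"
        using insert.hyps by auto
      then have "laplacian V E (\<lambda>u. if u \<in> insert v S then c u else 0)
          = laplacian V E (\<lambda>u. if u \<in> S then c u else 0)
            + (\<lambda>w. - c v * firing_vector E v w)"
        using insert.prems
        by (simp only: laplacian_add laplacian_scale firing_vector_eq_laplacian insert_subset)
      moreover have "firing_vector E v \<in> principal_divisors V E"
        using insert.prems by (auto simp: principal_divisors_def intro: group_closure.base)
      ultimately show ?case
        using insert scale unfolding principal_divisors_def
        by (simp only: group_closure_add insert_subset)
    qed
    from this[OF finite_vertices subset_refl]
    have "laplacian V E (\<lambda>u. if u \<in> V then c u else 0) \<in> principal_divisors V E" .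
    moreover have "laplacian V E (\<lambda>u. if u \<in> V then c u else 0) = laplacian V E c"
    proof
      fix v
      show "laplacian V E (\<lambda>u. if u \<in> V then c u else 0) v = laplacian V E c v"
        unfolding laplacian_def by (rule sum.cong) (auto simp: count_outside)
    qed
    ultimately show "laplacian V E c \<in> principal_divisors V E" by simp
  qed
qed

lemma winnable_iff:
  assumes "D \<in> divisors V"
  shows "winnable V E D \<longleftrightarrow> (\<exists>c. effective V (D - laplacian V E c))"
proof
  assume "winnable V E D"
  then obtain D' c where "effective V D'" "D - D' = laplacian V E c"
    unfolding winnable_def linearly_equivalent_def principal_divisors_eq by blast
  then have "D - laplacian V E c = D'" by (metis diff_diff_eq2 add_diff_cancel_left')
  with \<open>effective V D'\<close> show "\<exists>c. effective V (D - laplacian V E c)" by metis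
next
  assume "\<exists>c. effective V (D - laplacian V E c)"
  then obtain c where "effective V (D - laplacian V E c)" ..
  moreover have "D - laplacian V E c \<in> divisors V"
    using assms laplacian_in_divisors by (rule diff_in_divisors)
  moreover have "linearly_equivalent V E D (D - laplacian V E c)"
    by (simp add: linearly_equivalent_def principal_divisors_eq)
  ultimately show "winnable V E D" unfolding winnable_def by blast
qed

lemma winnable_imp_deg_nonneg:
  assumes "D \<in> divisors V" "winnable V E D"
  shows "0 \<le> deg V D"
proof -
  obtain c where "effective V (D - laplacian V E c)" using assms winnable_iff by blast
  then have "0 \<le> deg V (D - laplacian V E c)"
    unfolding deg_def effective_def by (intro sum_nonneg) auto
  then show ?thesis by (simp add: deg_diff deg_laplacian)
qed

section \<open>The rank as an attained minimum\<close>

lemma rank_attained: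
  assumes "D \<in> divisors V"
  shows "\<exists>F\<in>divisors V. effective V F \<and> \<not> winnable V E (D - F) \<and> rank V E D = deg V F - 1"
    and "\<And>F. F \<in> divisors V \<Longrightarrow> effective V F \<Longrightarrow> \<not> winnable V E (D - F)
          \<Longrightarrow> rank V E D \<le> deg V F - 1"
proof -
  define P where "P F \<longleftrightarrow> F \<in> divisors V \<and> effective V F \<and> \<not> winnable V E (D - F)" for F
  define M where "M = (ARG_MIN (deg V) F. P F)"
  have rank: "rank V E D = deg V M - 1"
    by (simp add: rank_def M_def P_def)
  have nonneg: "0 \<le> deg V F" if "P F" for F
    using that unfolding P_def effective_def deg_def by (intro sum_nonneg) auto
  have "\<exists>F. P F"
  proof -
    obtain q where q: "q \<in> V" using vertices_nonempty by blast
    define F where "F = (\<lambda>v. if v = q then \<bar>deg V D\<bar> + 1 else 0)"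
    have F: "F \<in> divisors V" "effective V F" "deg V F = \<bar>deg V D\<bar> + 1"
      using q finite_vertices by (auto simp: F_def divisors_def effective_def deg_def)
    then have "deg V (D - F) < 0" by (simp add: deg_diff)
    then have "\<not> winnable V E (D - F)"
      using winnable_imp_deg_nonneg[of "D - F"] diff_in_divisors[OF assms F(1)] by auto
    with F show ?thesis unfolding P_def by blast
  qed
  then obtain G where G: "P G" "\<forall>F. P F \<longrightarrow> nat (deg V G) \<le> nat (deg V F)"
    using ex_has_least_nat[of P _ "\<lambda>F. nat (deg V F)"] by blast
  have "is_arg_min (deg V) P G"
    unfolding is_arg_min_def using G nonneg by force
  then have M: "is_arg_min (deg V) P M"
    unfolding M_def arg_min_def by (rule someI[of "is_arg_min (deg V) P"])
  then show "\<exists>F\<in>divisors V. effective V F \<and> \<not> winnable V E (D - F)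
      \<and> rank V E D = deg V F - 1"
    using rank unfolding is_arg_min_def P_def by blast
  show "rank V E D \<le> deg V F - 1"
    if "F \<in> divisors V" "effective V F" "\<not> winnable V E (D - F)" for F
    using M that rank unfolding is_arg_min_def P_def by force
qed

section \<open>Divisors of vertex orders\<close>

definition order_divisor :: "('v \<Rightarrow> int) \<Rightarrow> 'v \<Rightarrow> int" where
  "order_divisor pos =
     (\<lambda>v. if v \<in> V then (\<Sum>w\<in>{w\<in>V. pos w < pos v}. int (count E {v, w})) - 1 else 0)"

lemma order_divisor_in_divisors: "order_divisor pos \<in> divisors V"
  by (simp add: order_divisor_def divisors_def)

text \<open>
  Each edge at v goes either to a smaller or to a larger vertex, so the two sums add up to
  the valence of v.
\<close>

lemma order_divisor_add_reverse:
  assumes "inj_on pos V"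
  shows "order_divisor pos + order_divisor (\<lambda>v. - pos v) = canonical_divisor V E"
proof
  fix v
  show "(order_divisor pos + order_divisor (\<lambda>v. - pos v)) v = canonical_divisor V E v"
  proof (cases "v \<in> V")
    case True
    let ?n = "\<lambda>w. int (count E {v, w})"
    have "int (val E v) = (\<Sum>w\<in>V. ?n w)" by (simp add: val_eq_sum[OF True])
    also have "\<dots> = (\<Sum>w\<in>{w\<in>V. pos w < pos v} \<union> {w\<in>V. pos v < pos w}. ?n w)"
    proof (rule sum.mono_neutral_right)
      show "\<forall>w\<in>V - ({w \<in> V. pos w < pos v} \<union> {w \<in> V. pos v < pos w}). ?n w = 0"
      proof
        fix w assume w: "w \<in> V - ({w \<in> V. pos w < pos v} \<union> {w \<in> V. pos v < pos w})"
        then have "pos w = pos v" by auto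
        with w True assms have "w = v" by (auto dest: inj_onD)
        then show "?n w = 0" by simp
      qed
    qed (use finite_vertices in auto)
    also have "\<dots> = (\<Sum>w\<in>{w\<in>V. pos w < pos v}. ?n w) + (\<Sum>w\<in>{w\<in>V. pos v < pos w}. ?n w)"
      by (rule sum.union_disjoint) (use finite_vertices in auto)
    finally show ?thesis using True by (simp add: order_divisor_def canonical_divisor_def)
  qed (simp add: order_divisor_def canonical_divisor_def)
qed

lemma deg_canonical_divisor: "deg V (canonical_divisor V E) = 2 * genus V E - 2"
proof -
  have "deg V (canonical_divisor V E) = int (\<Sum>v\<in>V. val E v) - 2 * int (card V)"
    by (simp add: deg_def canonical_divisor_def sum_subtractf)
  then show ?thesis unfolding sum_val by (simp add: genus_def)
qed

text \<open>
  Counting every edge at its smaller instead of its larger end shows that an order and its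
  reverse give the same degree, which is therefore half the degree of K.
\<close>

lemma deg_order_divisor:
  assumes "inj_on pos V"
  shows "deg V (order_divisor pos) = genus V E - 1"
proof -
  have as_double_sum: "deg V (order_divisor p)
      = (\<Sum>v\<in>V. \<Sum>w\<in>V. if p w < p v then int (count E {v, w}) else 0) - int (card V)" for p
    using finite_vertices
    by (simp add: deg_def order_divisor_def sum_subtractf sum.inter_filter)
  have "deg V (order_divisor (\<lambda>v. - pos v)) = deg V (order_divisor pos)"
    unfolding as_double_sum by (subst sum.swap) (simp add: insert_commute cong: if_cong)
  moreover have "deg V (order_divisor pos) + deg V (order_divisor (\<lambda>v. - pos v))
      = 2 * genus V E - 2"
    unfolding deg_canonical_divisor[symmetric] order_divisor_add_reverse[OF assms, symmetric]
    by (simp add: deg_def sum.distrib)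
  ultimately show ?thesis by simp
qed

text \<open>
  Consider the vertex v with the smallest number among those fired most often. It gains
  nothing along any edge, and it loses at least one chip along each edge to a smaller
  vertex, because that vertex is fired less often. As it has fewer chips than such edges,
  it ends in debt.
\<close>

lemma not_winnable_below_order_divisor:
  assumes "D \<in> divisors V" and below: "\<And>v. v \<in> V \<Longrightarrow> D v \<le> order_divisor pos v"
  shows "\<not> winnable V E D"
proof
  assume "winnable V E D"
  then obtain c where c: "effective V (D - laplacian V E c)"
    using assms winnable_iff by blast
  define A where "A = {v \<in> V. \<forall>w\<in>V. c w \<le> c v}"
  have "finite A" using finite_vertices by (simp add: A_def)
  have "Max (c ` V) \<in> c ` V" using finite_vertices vertices_nonempty by simp
  then obtain u where "u \<in> V" "c u = Max (c ` V)" by auto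
  then have "u \<in> A" using finite_vertices by (auto simp: A_def)
  then have "Min (pos ` A) \<in> pos ` A" using \<open>finite A\<close> by (intro Min_in) auto
  then obtain v where v: "v \<in> A" "pos v = Min (pos ` A)" by auto
  then have first: "pos v \<le> pos w" if "w \<in> A" for w
    using that \<open>finite A\<close> by simp
  have "v \<in> V" using v by (simp add: A_def)
  have "(\<Sum>w\<in>{w\<in>V. pos w < pos v}. int (count E {v, w}))
      \<le> (\<Sum>w\<in>{w\<in>V. pos w < pos v}. int (count E {v, w}) * (c v - c w))"
  proof (rule sum_mono)
    fix w assume w: "w \<in> {w \<in> V. pos w < pos v}"
    then have "w \<notin> A" using first by force
    then obtain x where "x \<in> V" "c w < c x" using w by (auto simp: A_def not_le)
    then have "c w < c v" using v by (auto simp: A_def)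
    then have "int (count E {v, w}) * 1 \<le> int (count E {v, w}) * (c v - c w)"
      by (intro mult_left_mono) auto
    then show "int (count E {v, w}) \<le> int (count E {v, w}) * (c v - c w)" by simp
  qed
  also have "\<dots> \<le> laplacian V E c v"
    unfolding laplacian_def using finite_vertices v by (intro sum_mono2) (auto simp: A_def)
  finally have "order_divisor pos v < laplacian V E c v"
    using \<open>v \<in> V\<close> by (simp add: order_divisor_def)
  with below[OF \<open>v \<in> V\<close>] c \<open>v \<in> V\<close> show False by (force simp: effective_def)
qed

text \<open>
  This is Dhar's burning algorithm. The fire has reached a set B of vertices; by
  assumption some vertex outside B has fewer chips than edges to B, and it burns next.
  The order divisor of the resulting order bounds D.
\<close>

lemma below_order_divisor_if_burns:
  assumes burns: "\<And>S. S \<noteq> {} \<Longrightarrow> S \<subseteq> V \<Longrightarrow>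
    \<exists>v\<in>S. D v < (\<Sum>w\<in>V - S. int (count E {v, w}))"
  obtains pos where "inj_on pos V" "\<And>v. v \<in> V \<Longrightarrow> D v \<le> order_divisor pos v"
proof -
  have "\<exists>B (pos :: 'v \<Rightarrow> int). B \<subseteq> V \<and> card B = k \<and> inj_on pos B \<and>
      (\<forall>v\<in>B. D v < (\<Sum>w\<in>{w\<in>B. pos w < pos v}. int (count E {v, w})))"
    if "k \<le> card V" for k
    using that
  proof (induction k)
    case 0
    show ?case by (intro exI[of _ "{}"]) auto
  next
    case (Suc k)
    then obtain B and pos :: "'v \<Rightarrow> int" where B: "B \<subseteq> V" "card B = k" "inj_on pos B"
      and bound: "\<forall>v\<in>B. D v < (\<Sum>w\<in>{w\<in>B. pos w < pos v}. int (count E {v, w}))"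
      by auto
    have "finite B" using B(1) finite_vertices finite_subset by blast
    have "V - B \<noteq> {}"
    proof
      assume "V - B = {}"
      with B(1) have "V = B" by auto
      with B(2) Suc.prems show False by simp
    qed
    with burns[of "V - B"] B(1) obtain v where v: "v \<in> V" "v \<notin> B"
      "D v < (\<Sum>w\<in>B. int (count E {v, w}))"
      by (auto simp: double_diff)
    obtain m where m: "\<forall>w\<in>B. pos w < m"
      using finite_imageI[OF \<open>finite B\<close>, of pos]
      by (metis Max_ge imageI less_add_one le_less_trans)
    define pos' where "pos' = pos(v := m)"
    have "{w \<in> insert v B. pos' w < pos' u} = {w \<in> B. pos w < pos u}" if "u \<in> B" for u
      using that m v(2) by (force simp: pos'_def)
    moreover have "{w \<in> insert v B. pos' w < pos' v} = B"
      using m v(2) by (auto simp: pos'_def)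
    ultimately have "\<forall>u\<in>insert v B. D u
        < (\<Sum>w\<in>{w \<in> insert v B. pos' w < pos' u}. int (count E {u, w}))"
      using bound v by simp
    moreover have "inj_on pos' (insert v B)"
      using B(3) m v(2) by (auto simp: inj_on_def pos'_def)
    moreover have "card (insert v B) = Suc k" "insert v B \<subseteq> V"
      using B v \<open>finite B\<close> by auto
    ultimately show ?case by blast
  qed
  from this[of "card V"] obtain B and pos :: "'v \<Rightarrow> int" where B: "B \<subseteq> V" "card B = card V"
    and pos: "inj_on pos B"
      "\<forall>v\<in>B. D v < (\<Sum>w\<in>{w\<in>B. pos w < pos v}. int (count E {v, w}))"
    by auto
  have "B = V" using B finite_vertices card_subset_eq by blast
  with pos show thesis by (intro that[of pos]) (auto simp: order_divisor_def)
qed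

lemma laplacian_indicator:
  assumes "S \<subseteq> V"
  shows "laplacian V E (indicator S) v
    = (if v \<in> S then (\<Sum>w\<in>V - S. int (count E {v, w})) else - (\<Sum>w\<in>S. int (count E {v, w})))"
proof (cases "v \<in> S")
  case True
  have "laplacian V E (indicator S) v = (\<Sum>w\<in>V - S. int (count E {v, w}))"
    unfolding laplacian_def using True finite_vertices
    by (intro sum.mono_neutral_cong_right) auto
  with True show ?thesis by simp
next
  case False
  have "laplacian V E (indicator S) v = (\<Sum>w\<in>S. - int (count E {v, w}))"
    unfolding laplacian_def using False finite_vertices assms
    by (intro sum.mono_neutral_cong_right) auto
  with False show ?thesis by (simp add: sum_negf)
qed

end

section \<open>Unwinnable divisors lie below order divisors\<close>

context connected_multigraph
begin

text \<open>
  Firing the script b costs every vertex other than q at least one chip. This serves two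
  purposes: firing it backwards often enough clears every debt outside q, and pairing
  divisors with it gives a potential that drops whenever a nonempty set not containing q is
  fired.

  It is built by letting a set B, on which the Laplacian is already positive except at q,
  absorb a neighbour u of B. Adding the indicator of the complement of B makes the
  Laplacian positive at u and does not decrease it outside B; the damage to B is bounded
  by the valences and is made good by scaling the old script first.
\<close>

lemma obtain_potential:
  assumes "q \<in> V"
  obtains b where "b q = 0" "\<And>v. 0 \<le> b v" "\<And>v. v \<in> V \<Longrightarrow> v \<noteq> q \<Longrightarrow> 1 \<le> laplacian V E b v"
proof -
  have "\<exists>B b. q \<in> B \<and> B \<subseteq> V \<and> card B = Suc k \<and> b q = 0 \<and> (\<forall>v. 0 \<le> b v) \<and>
      (\<forall>v\<in>B - {q}. 1 \<le> laplacian V E b v) \<and> (\<forall>v\<in>V - B. 0 \<le> laplacian V E b v)"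
    if "Suc k \<le> card V" for k
    using that
  proof (induction k)
    case 0
    show ?case
      using assms by (intro exI[of _ "{q}"] exI[of _ 0]) (auto simp: laplacian_zero zero_fun_def[symmetric])
  next
    case (Suc k)
    then obtain B b where B: "q \<in> B" "B \<subseteq> V" "card B = Suc k" and b: "b q = 0" "\<forall>v. 0 \<le> b v"
      "\<forall>v\<in>B - {q}. 1 \<le> laplacian V E b v" "\<forall>v\<in>V - B. 0 \<le> laplacian V E b v"
      by auto
    have "finite B" using B finite_vertices finite_subset by blast
    have "B \<subset> V" using B Suc.prems by auto
    then obtain x u where xu: "x \<in> B" "u \<in> V - B" "{x, u} \<in># E"
      using connected[of B] B by auto
    define M where "M = 1 + (\<Sum>v\<in>V. \<Sum>w\<in>V. int (count E {v, w}))"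
    define b' where "b' = (\<lambda>v. M * b v) + indicator (V - B)"
    have M_ge: "1 + (\<Sum>w\<in>V - B. int (count E {v, w})) \<le> M" if "v \<in> V" for v
    proof -
      have "(\<Sum>w\<in>V - B. int (count E {v, w})) \<le> (\<Sum>w\<in>V. int (count E {v, w}))"
        using finite_vertices by (intro sum_mono2) auto
      also have "\<dots> \<le> (\<Sum>v\<in>V. \<Sum>w\<in>V. int (count E {v, w}))"
        using finite_vertices that by (intro member_le_sum) (auto intro: sum_nonneg)
      finally show ?thesis by (simp add: M_def)
    qed
    have "0 \<le> M" by (auto simp: M_def intro!: add_nonneg_nonneg sum_nonneg)
    have lap: "laplacian V E b' v
        = M * laplacian V E b v + laplacian V E (indicator (V - B)) v" for v
      by (simp add: b'_def laplacian_add laplacian_scale)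
    have in_B: "1 \<le> laplacian V E b' v" if v: "v \<in> B - {q}" for v
    proof -
      have "M * 1 \<le> M * laplacian V E b v"
        using v b(3) \<open>0 \<le> M\<close> by (intro mult_left_mono) auto
      moreover have "v \<in> V" using v B by auto
      ultimately show ?thesis
        using v M_ge[OF \<open>v \<in> V\<close>] by (simp add: lap laplacian_indicator)
    qed
    have off_B: "(\<Sum>w\<in>B. int (count E {v, w})) \<le> laplacian V E b' v" if v: "v \<in> V - B" for v
      using v b(4) \<open>0 \<le> M\<close> B(2) by (simp add: lap laplacian_indicator double_diff)
    have "1 \<le> int (count E {u, x})" using xu(3) by (simp add: insert_commute Suc_le_eq)
    also have "\<dots> \<le> (\<Sum>w\<in>B. int (count E {u, w}))"
      using xu \<open>finite B\<close> by (intro member_le_sum) auto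
    also have "\<dots> \<le> laplacian V E b' u" using off_B xu by simp
    finally have "\<forall>v\<in>insert u B - {q}. 1 \<le> laplacian V E b' v" using in_B by auto
    moreover have "\<forall>v\<in>V - insert u B. 0 \<le> laplacian V E b' v"
    proof
      fix v assume "v \<in> V - insert u B"
      then have "(\<Sum>w\<in>B. int (count E {v, w})) \<le> laplacian V E b' v" using off_B by simp
      moreover have "0 \<le> (\<Sum>w\<in>B. int (count E {v, w}))" by (simp add: sum_nonneg)
      ultimately show "0 \<le> laplacian V E b' v" by linarith
    qed
    moreover have "\<forall>v. 0 \<le> b' v" using b(2) \<open>0 \<le> M\<close> by (auto simp: b'_def)
    moreover have "b' q = 0" using b(1) B(1) by (simp add: b'_def)
    moreover have "card (insert u B) = Suc (Suc k)" "q \<in> insert u B" "insert u B \<subseteq> V"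
      using B xu \<open>finite B\<close> by auto
    ultimately show ?case by blast
  qed
  moreover have "0 < card V" using finite_vertices vertices_nonempty by (simp add: card_gt_0_iff)
  ultimately obtain B b where "B \<subseteq> V" "card B = card V" "b q = 0" "\<forall>v. 0 \<le> b v"
    "\<forall>v\<in>B - {q}. 1 \<le> laplacian V E b v"
    by (metis Suc_pred' order_refl)
  moreover from this have "B = V" using finite_vertices card_subset_eq by blast
  ultimately show thesis by (intro that[of b]) auto
qed

text \<open>
  Among the divisors equivalent to D with no debt outside q, take one of least potential.
  Being unwinnable, it has debt at q, which firing a set containing q cannot relieve.
  Firing a nonempty set S that does not contain q lowers the potential, so by minimality
  it puts some vertex other than q into debt; such a vertex lies in S.
\<close>

lemma unwinnable_equivalent_below_order_divisor:
  assumes D: "D \<in> divisors V" and unwinnable: "\<not> winnable V E D"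
  obtains pos c where "inj_on pos V"
    "\<And>v. v \<in> V \<Longrightarrow> (D - laplacian V E c) v \<le> order_divisor pos v"
proof -
  obtain q where q: "q \<in> V" using vertices_nonempty by blast
  obtain b where b: "b q = 0" "\<And>v. 0 \<le> b v"
    "\<And>v. v \<in> V \<Longrightarrow> v \<noteq> q \<Longrightarrow> 1 \<le> laplacian V E b v"
    using obtain_potential[OF q] by blast
  define ok where "ok c \<longleftrightarrow> (\<forall>v\<in>V - {q}. 0 \<le> (D - laplacian V E c) v)" for c
  define potential where "potential c = (\<Sum>v\<in>V. (D - laplacian V E c) v * b v)" for c
  have potential_nonneg: "0 \<le> potential c" if "ok c" for c
    unfolding potential_def
  proof (rule sum_nonneg)
    fix v assume "v \<in> V"
    with that b show "0 \<le> (D - laplacian V E c) v * b v"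
      by (cases "v = q") (auto simp: ok_def)
  qed
  have "\<exists>c. ok c"
  proof
    define N where "N = (\<Sum>v\<in>V. \<bar>D v\<bar>)"
    show "ok (\<lambda>v. - N * b v)"
      unfolding ok_def
    proof
      fix v assume v: "v \<in> V - {q}"
      have "0 \<le> N" unfolding N_def by (rule sum_nonneg) simp
      then have "N * 1 \<le> N * laplacian V E b v" using b v by (intro mult_left_mono) auto
      moreover have "\<bar>D v\<bar> \<le> N"
        unfolding N_def using finite_vertices v by (intro member_le_sum) auto
      ultimately show "0 \<le> (D - laplacian V E (\<lambda>v. - N * b v)) v"
        by (simp only: minus_apply laplacian_scale)
    qed
  qed
  then obtain c where c: "ok c" "\<forall>c'. ok c' \<longrightarrow> nat (potential c) \<le> nat (potential c')"
    using ex_has_least_nat[of ok _ "\<lambda>c. nat (potential c)"] by blast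
  let ?D = "D - laplacian V E c"
  have "?D q < 0"
  proof (rule ccontr)
    assume "\<not> ?D q < 0"
    then have "effective V ?D" using c(1) unfolding effective_def ok_def by force
    with unwinnable D show False by (auto simp: winnable_iff)
  qed
  have "\<exists>v\<in>S. ?D v < (\<Sum>w\<in>V - S. int (count E {v, w}))" if S: "S \<noteq> {}" "S \<subseteq> V" for S
  proof (cases "q \<in> S")
    case True
    have "0 \<le> (\<Sum>w\<in>V - S. int (count E {q, w}))" by (simp add: sum_nonneg)
    with \<open>?D q < 0\<close> have "?D q < (\<Sum>w\<in>V - S. int (count E {q, w}))" by linarith
    with True show ?thesis by blast
  next
    case False
    show ?thesis
    proof (rule ccontr)
      assume "\<not> ?thesis"
      then have legal: "\<forall>v\<in>S. (\<Sum>w\<in>V - S. int (count E {v, w})) \<le> ?D v" by (simp add: not_less)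
      define c' where "c' = c + indicator S"
      have "ok c'"
        unfolding ok_def
      proof
        fix v assume v: "v \<in> V - {q}"
        have "(D - laplacian V E c') v = ?D v - laplacian V E (indicator S) v"
          by (simp add: c'_def laplacian_add)
        moreover have "laplacian V E (indicator S) v \<le> ?D v"
        proof (cases "v \<in> S")
          case True
          with legal S show ?thesis by (simp add: laplacian_indicator)
        next
          case False
          have "0 \<le> ?D v" using c(1) v unfolding ok_def by blast
          moreover have "0 \<le> (\<Sum>w\<in>S. int (count E {v, w}))" by (simp add: sum_nonneg)
          ultimately show ?thesis using False S by (simp add: laplacian_indicator)
        qed
        ultimately show "0 \<le> (D - laplacian V E c') v" by simp
      qed
      have "finite S" using S finite_vertices finite_subset by blast
      have "potential c - potential c' = (\<Sum>v\<in>V. laplacian V E (indicator S) v * b v)"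
        by (simp add: potential_def c'_def laplacian_add algebra_simps flip: sum_subtractf)
      also have "\<dots> = (\<Sum>v\<in>V. indicator S v * laplacian V E b v)"
        by (rule sum_laplacian_mult)
      also have "\<dots> = (\<Sum>v\<in>S. laplacian V E b v)"
        using S finite_vertices by (intro sum.mono_neutral_cong_right) auto
      also have "\<dots> > 0"
      proof (rule sum_pos)
        fix v assume "v \<in> S"
        then have "v \<in> V" "v \<noteq> q" using S False by auto
        from b(3)[OF this] show "0 < laplacian V E b v" by simp
      qed (use S \<open>finite S\<close> in auto)
      finally have "potential c' < potential c" by simp
      with c \<open>ok c'\<close> potential_nonneg[OF \<open>ok c'\<close>] show False by force
    qed
  qed
  then obtain pos where "inj_on pos V" "\<And>v. v \<in> V \<Longrightarrow> ?D v \<le> order_divisor pos v"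
    using below_order_divisor_if_burns[of ?D] by blast
  then show thesis by (rule that)
qed

section \<open>The Riemann--Roch theorem\<close>

lemma rank_canonical_minus_le:
  assumes D: "D \<in> divisors V"
  shows "rank V E (canonical_divisor V E - D) \<le> rank V E D - (deg V D + 1 - genus V E)"
proof -
  let ?K = "canonical_divisor V E"
  obtain F where F: "F \<in> divisors V" "effective V F" "\<not> winnable V E (D - F)"
    and rank_D: "rank V E D = deg V F - 1"
    using rank_attained(1)[OF D] by blast
  obtain pos c where pos: "inj_on pos V"
    and below: "\<And>v. v \<in> V \<Longrightarrow> (D - F - laplacian V E c) v \<le> order_divisor pos v"
    using unwinnable_equivalent_below_order_divisor[OF diff_in_divisors[OF D F(1)] F(3)] by blast
  define F' where "F' = order_divisor pos - (D - F - laplacian V E c)"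
  have K: "?K \<in> divisors V" by (simp add: divisors_def canonical_divisor_def)
  have F': "F' \<in> divisors V" "effective V F'"
    using below D F(1)
    by (auto simp: F'_def effective_def
        intro!: diff_in_divisors order_divisor_in_divisors laplacian_in_divisors)
  have K_D_F': "?K - D - F' = order_divisor (\<lambda>v. - pos v) - F - laplacian V E c"
    unfolding order_divisor_add_reverse[OF pos, symmetric] F'_def by simp
  have unwinnable_reverse: "\<not> winnable V E (order_divisor (\<lambda>v. - pos v) - F)"
    using F(1,2) by (intro not_winnable_below_order_divisor[where pos = "\<lambda>v. - pos v"]
        diff_in_divisors order_divisor_in_divisors) (auto simp: effective_def)
  have "\<not> winnable V E (?K - D - F')"
  proof
    assume "winnable V E (?K - D - F')"
    then obtain d where "effective V (?K - D - F' - laplacian V E d)"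
      using winnable_iff[OF diff_in_divisors[OF diff_in_divisors[OF K D] F'(1)]] by blast
    also have "?K - D - F' - laplacian V E d
        = order_divisor (\<lambda>v. - pos v) - F - laplacian V E (c + d)"
      unfolding K_D_F' laplacian_add by (simp add: algebra_simps)
    finally show False
      using unwinnable_reverse winnable_iff[OF diff_in_divisors[OF order_divisor_in_divisors F(1)]]
      by blast
  qed
  from rank_attained(2)[OF diff_in_divisors[OF K D] F' this]
  have "rank V E (?K - D) \<le> deg V F' - 1" .
  also have "deg V F' = genus V E - 1 - deg V D + deg V F"
    by (simp add: F'_def deg_diff deg_laplacian deg_order_divisor[OF pos])
  finally show ?thesis using rank_D by linarith
qed

end

theorem theorem3p1:
  fixes V :: "'v set" and E :: "'v set multiset" and D :: "'v \<Rightarrow> int"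
  assumes "connected_multigraph V E"
    and "D \<in> divisors V"
  shows "rank V E D - rank V E (canonical_divisor V E - D) = deg V D + 1 - genus V E"
proof -
  interpret connected_multigraph V E by fact
  let ?K = "canonical_divisor V E"
  have "?K - D \<in> divisors V"
    using assms(2) by (simp add: divisors_def canonical_divisor_def)
  from rank_canonical_minus_le[OF this]
  have "rank V E D \<le> rank V E (?K - D) - (deg V (?K - D) + 1 - genus V E)" by simp
  moreover have "deg V (?K - D) = 2 * genus V E - 2 - deg V D"
    by (simp add: deg_diff deg_canonical_divisor)
  ultimately show ?thesis using rank_canonical_minus_le[OF assms(2)] by linarith
qed

end
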